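(* Let $r>1$ be a fixed integer and, for each integer $s\ge 2$, let $\delta_{r,s}$ be the relative gain in expected value of the advantage experiment with $r$ rolls of a fair $s$-sided die. Then $$\lim_{s\to\infty}\delta_{r,s}=\frac{r-1}{r+1}.$$
   Context: A fair $s$-sided die takes each value in $\{1,\dots,s\}$ with equal probability. The base experiment is rolling the die once; $X$ denotes its outcome, so $E[X]=\frac{s+1}{2}$. An advantage experiment consists of rolling the die $r$ times (independently, so that all $s^r$ sequences in $\{1,\dots,s\}^r$ are equally likely) and taking the largest number rolled as the outcome; $H_{r,s}$ is the random variable giving this outcome, i.e. $H_{r,s}=\max(X_1,\dots,X_r)$ with $X_1,\dots,X_r$ independent and uniform on $\{1,\dots,s\}$. The relative gain in expected value of the advantage experiment is $$\delta_{r,s}=\frac{E[H_{r,s}]-E[X]}{E[X]}.$$ *)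

theory Defs
  imports "HOL-Probability.Probability"
begin

text \<open>
  The side count \<open>s\<close> is meant to be positive: for \<open>s = 0\<close> the underlying set is empty and
  \<^const>\<open>pmf_of_set\<close> is unspecified.
\<close>

definition die :: "nat \<Rightarrow> nat pmf" where
  "die s = pmf_of_set {1..s}"

text \<open>
  The sample space of the advantage experiment consists of the lists of length \<open>r\<close> of independent
  rolls; the outcome is the largest entry of the list. It is meaningful for \<open>r \<ge> 1\<close>.
\<close>

definition advantage_rolls :: "nat \<Rightarrow> nat \<Rightarrow> nat list pmf" where
  "advantage_rolls r s = replicate_pmf r (die s)"

definition highest_roll :: "nat list \<Rightarrow> nat" where
  "highest_roll xs = Max (set xs)"

definition expected_base :: "nat \<Rightarrow> real" where
  "expected_base s = measure_pmf.expectation (die s) real"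

definition expected_advantage :: "nat \<Rightarrow> nat \<Rightarrow> real" where
  "expected_advantage r s =
     measure_pmf.expectation (advantage_rolls r s) (\<lambda>xs. real (highest_roll xs))"

definition relative_gain :: "nat \<Rightarrow> nat \<Rightarrow> real" where
  "relative_gain r s = (expected_advantage r s - expected_base s) / expected_base s"

end

theory Submission
  imports Defs
begin

text \<open>
  The tail-sum formula gives \<open>E[H] = (\<Sum>k<s. 1 - (k/s)^r)\<close>, because the maximum is at most \<open>k\<close> exactly
  when all rolls are. The power sum \<open>\<Sum>k<s. k^r\<close> is asymptotic to \<open>s^(r+1)/(r+1)\<close> by telescoping,
  so \<open>E[H]/s\<close> tends to \<open>r/(r+1)\<close>, whereas \<open>E[X]/s\<close> tends to \<open>1/2\<close>.
\<close>

text \<open>This is independence of the rolls: conditioned on the first entry \<open>x\<close>, the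
  remaining entries contribute the factor from the induction hypothesis if \<open>x\<close> lies in
  \<open>A\<close>, and the event is empty otherwise. Working with \<open>emeasure\<close> turns the
  bind into a nonnegative integral, so no integrability has to be checked.\<close>

lemma emeasure_replicate_pmf_lists:
  "emeasure (replicate_pmf n p) (lists A) = emeasure p A ^ n"
proof (induction n)
  case 0
  then show ?case by simp
next
  case (Suc n)
  have cons: "emeasure (map_pmf ((#) x) (replicate_pmf n p)) (lists A) =
      emeasure p A ^ n * indicator A x" for x
  proof -
    have "(#) x -` lists A = (if x \<in> A then lists A else {})"
      by auto
    then show ?thesis by (simp add: Suc)
  qed
  have "replicate_pmf (Suc n) p = p \<bind> (\<lambda>x. map_pmf ((#) x) (replicate_pmf n p))"
    by (simp add: map_pmf_def)
  then have "emeasure (replicate_pmf (Suc n) p) (lists A) =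
      (\<integral>\<^sup>+x. emeasure p A ^ n * indicator A x \<partial>p)"
    by (simp only: emeasure_bind_pmf cons)
  also have "\<dots> = emeasure p A ^ Suc n"
    by (subst nn_integral_cmult_indicator) (simp_all add: mult.commute)
  finally show ?case .
qed

lemma measure_replicate_pmf_lists:
  "measure_pmf.prob (replicate_pmf n p) (lists A) = measure_pmf.prob p A ^ n"
  using emeasure_replicate_pmf_lists[of n p A]
  by (simp add: measure_pmf.emeasure_eq_measure ennreal_power)

lemma expected_base_eq:
  assumes "s > 0"
  shows "expected_base s = (real s + 1) / 2"
proof -
  have "2 * (\<Sum>i=1..s. real i) = real s * (real s + 1)"
    by (induction s) (auto simp: algebra_simps)
  then have "(\<Sum>i=1..s. real i) = real s * (real s + 1) / 2"
    by simp
  then show ?thesis using assms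
    by (simp add: expected_base_def die_def integral_pmf_of_set)
qed

lemma prob_die_atMost:
  assumes "k < s"
  shows "measure_pmf.prob (die s) {..k} = real k / real s"
proof -
  have "{1..s} \<inter> {..k} = {1..k}" using assms by auto
  then show ?thesis using assms
    by (simp add: die_def measure_pmf_of_set)
qed

lemma expected_advantage_eq:
  assumes "s > 0" "r > 0"
  shows "expected_advantage r s = (\<Sum>k<s. 1 - (real k / real s) ^ r)"
proof -
  \<comment> \<open>The tail sum is first proved pointwise. Restricting to the support gives the
    bound \<open>s\<close> on the maximum and, since \<open>r > 0\<close>, excludes the empty list,
    where \<open>Max\<close> is unspecified.\<close>
  have highest: "real (highest_roll xs) = (\<Sum>k<s. 1 - indicator (lists {..k}) xs)"
    if "xs \<in> set_pmf (advantage_rolls r s)" for xs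
  proof -
    have xs: "set xs \<subseteq> {1..s}" "xs \<noteq> []"
      using that assms by (auto simp: advantage_rolls_def die_def set_replicate_pmf)
    then have le: "highest_roll xs \<le> s"
      by (auto simp: highest_roll_def)
    have "(1::real) - indicator (lists {..k}) xs = (if k < highest_roll xs then 1 else 0)" for k
    proof -
      have "xs \<in> lists {..k} \<longleftrightarrow> highest_roll xs \<le> k"
        using xs by (auto simp: highest_roll_def in_lists_conv_set)
      then show ?thesis by (simp add: indicator_def)
    qed
    \<comment> \<open>The sum counts the \<open>k\<close> below both \<open>s\<close> and the
      maximum; as the maximum is at most \<open>s\<close>, there are exactly as many as its
      value.\<close>
    then have "(\<Sum>k<s. (1::real) - indicator (lists {..k}) xs) = card ({..<s} \<inter> {k. k < highest_roll xs})"
      by (simp add: sum.If_cases)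
    also have "{..<s} \<inter> {k. k < highest_roll xs} = {..<highest_roll xs}"
      using le by auto
    finally show ?thesis by simp
  qed
  have "expected_advantage r s =
      measure_pmf.expectation (advantage_rolls r s) (\<lambda>xs. \<Sum>k<s. 1 - indicator (lists {..k}) xs)"
    unfolding expected_advantage_def
    by (rule integral_cong_AE) (auto simp: AE_measure_pmf_iff highest)
  also have "\<dots> = (\<Sum>k<s. 1 - measure_pmf.prob (advantage_rolls r s) (lists {..k}))"
    by (subst Bochner_Integration.integral_sum)
       (auto intro!: sum.cong simp: measure_pmf.emeasure_eq_measure)
  also have "\<dots> = (\<Sum>k<s. 1 - (real k / real s) ^ r)"
    by (intro sum.cong) (simp_all add: advantage_rolls_def measure_replicate_pmf_lists prob_die_atMost)
  finally show ?thesis .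
qed

text \<open>A mean value estimate without derivatives: in the factorisation of the difference, the
  cofactor of \<open>y - x\<close> has \<open>Suc n\<close> summands, each between
  \<open>x ^ n\<close> and \<open>y ^ n\<close>.\<close>

lemma power_Suc_diff_bounds:
  fixes x y :: real
  assumes "0 \<le> x" "x \<le> y"
  shows "real (Suc n) * x ^ n * (y - x) \<le> y ^ Suc n - x ^ Suc n"
    and "y ^ Suc n - x ^ Suc n \<le> real (Suc n) * y ^ n * (y - x)"
proof -
  have eq: "y ^ Suc n - x ^ Suc n = (y - x) * (\<Sum>i<Suc n. y ^ i * x ^ (n - i))"
    using power_diff_sumr2[of y "Suc n" x] by (simp add: mult.commute)
  have "(\<Sum>i<Suc n. x ^ n) \<le> (\<Sum>i<Suc n. y ^ i * x ^ (n - i))"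
  proof (rule sum_mono)
    fix i assume "i \<in> {..<Suc n}"
    then have "x ^ n = x ^ i * x ^ (n - i)" by (simp flip: power_add)
    also have "\<dots> \<le> y ^ i * x ^ (n - i)"
      using assms by (intro mult_right_mono power_mono) auto
    finally show "x ^ n \<le> y ^ i * x ^ (n - i)" .
  qed
  from mult_left_mono[OF this, of "y - x"]
  show "real (Suc n) * x ^ n * (y - x) \<le> y ^ Suc n - x ^ Suc n"
    unfolding eq using assms by (simp add: mult_ac del: sum.lessThan_Suc)
  have "(\<Sum>i<Suc n. y ^ i * x ^ (n - i)) \<le> (\<Sum>i<Suc n. y ^ n)"
  proof (rule sum_mono)
    fix i assume "i \<in> {..<Suc n}"
    then have "y ^ n = y ^ i * y ^ (n - i)" by (simp flip: power_add)
    also have "y ^ i * x ^ (n - i) \<le> \<dots>"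
      using assms by (intro mult_left_mono power_mono) auto
    finally show "y ^ i * x ^ (n - i) \<le> y ^ n" .
  qed
  from mult_left_mono[OF this, of "y - x"]
  show "y ^ Suc n - x ^ Suc n \<le> real (Suc n) * y ^ n * (y - x)"
    unfolding eq using assms by (simp add: mult_ac del: sum.lessThan_Suc)
qed

text \<open>Apply the preceding estimate to consecutive integers and telescope. The lower estimate
  yields the first bound; the upper one yields the second, with the index shifted by one, whence the
  extra term \<open>real m ^ n\<close>.\<close>

lemma sum_power_bounds:
  assumes "n > 0"
  shows "real (Suc n) * (\<Sum>k<m. real k ^ n) \<le> real m ^ Suc n"
    and "real m ^ Suc n \<le> real (Suc n) * ((\<Sum>k<m. real k ^ n) + real m ^ n)"
proof -
  have tel: "(\<Sum>k<m. real (Suc k) ^ Suc n - real k ^ Suc n) = real m ^ Suc n"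
    by (subst sum_lessThan_telescope) simp
  have "real (Suc n) * (\<Sum>k<m. real k ^ n) = (\<Sum>k<m. real (Suc n) * real k ^ n)"
    by (rule sum_distrib_left)
  also have "\<dots> \<le> (\<Sum>k<m. real (Suc k) ^ Suc n - real k ^ Suc n)"
    using power_Suc_diff_bounds(1)[of "real k" "real (Suc k)" n for k]
    by (intro sum_mono) (simp del: power_Suc)
  finally show "real (Suc n) * (\<Sum>k<m. real k ^ n) \<le> real m ^ Suc n"
    unfolding tel .
  have "real m ^ Suc n \<le> (\<Sum>k<m. real (Suc n) * real (Suc k) ^ n)"
    unfolding tel[symmetric]
    using power_Suc_diff_bounds(2)[of "real k" "real (Suc k)" n for k]
    by (intro sum_mono) (simp del: power_Suc)
  also have "\<dots> = real (Suc n) * (\<Sum>k<m. real (Suc k) ^ n)"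
    by (rule sum_distrib_left[symmetric])
  \<comment> \<open>The shift adds the term for \<open>k = 0\<close>, which vanishes because
    \<open>n > 0\<close>; for \<open>n = 0\<close> it would be 1.\<close>
  also have "(\<Sum>k<m. real (Suc k) ^ n) = (\<Sum>k<Suc m. real k ^ n)"
    using assms by (subst sum.lessThan_Suc_shift) simp
  finally show "real m ^ Suc n \<le> real (Suc n) * ((\<Sum>k<m. real k ^ n) + real m ^ n)"
    by simp
qed

lemma sum_power_asymptotics:
  assumes "n > 0"
  shows "(\<lambda>m. (\<Sum>k<m. real k ^ n) / real m ^ Suc n) \<longlonglongrightarrow> 1 / real (Suc n)"
proof (rule tendsto_sandwich)
  \<comment> \<open>The error \<open>1 / real m\<close> is the extra term \<open>real m ^ n\<close>
    divided by \<open>real m ^ Suc n\<close>.\<close>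
  show "\<forall>\<^sub>F m in sequentially.
      1 / real (Suc n) - 1 / real m \<le> (\<Sum>k<m. real k ^ n) / real m ^ Suc n"
    using eventually_gt_at_top[of 0]
  proof eventually_elim
    case (elim m)
    have "real m ^ Suc n / real (Suc n) \<le> (\<Sum>k<m. real k ^ n) + real m ^ n"
      using sum_power_bounds(2)[OF assms, of m]
      by (subst pos_divide_le_eq) (simp_all add: mult.commute)
    then have "real m ^ Suc n / real (Suc n) / real m ^ Suc n
        \<le> ((\<Sum>k<m. real k ^ n) + real m ^ n) / real m ^ Suc n"
      by (rule divide_right_mono) simp
    with elim show ?case by (simp add: add_divide_distrib)
  qed
  show "\<forall>\<^sub>F m in sequentially. (\<Sum>k<m. real k ^ n) / real m ^ Suc n \<le> 1 / real (Suc n)"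
    using eventually_gt_at_top[of 0]
  proof eventually_elim
    case (elim m)
    with sum_power_bounds(1)[OF assms, of m] show ?case
      by (simp add: divide_le_eq le_divide_eq mult.commute del: of_nat_Suc power_Suc)
  qed
  have "(\<lambda>m. 1 / real (Suc n) - 1 / real m) \<longlonglongrightarrow> 1 / real (Suc n) - 0"
    by (intro tendsto_intros lim_1_over_n)
  then show "(\<lambda>m. 1 / real (Suc n) - 1 / real m) \<longlonglongrightarrow> 1 / real (Suc n)"
    by simp
qed simp

theorem corollary3p1p2:
  fixes r :: nat
  assumes "r > 1"
  shows "(\<lambda>s. relative_gain r s) \<longlonglongrightarrow> (real r - 1) / (real r + 1)"
proof -
  \<comment> \<open>The normalisation is chosen so that the expected maximum becomes
    \<open>real s * (1 - t s)\<close>.\<close>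
  define t where "t s = (\<Sum>k<s. real k ^ r) / real s ^ Suc r" for s
  have "t \<longlonglongrightarrow> 1 / real (Suc r)"
    unfolding t_def using assms by (intro sum_power_asymptotics) simp
  then have "(\<lambda>s. (1 - 1 / real s - 2 * t s) / (1 + 1 / real s))
      \<longlonglongrightarrow> (1 - 0 - 2 * (1 / real (Suc r))) / (1 + 0)"
    by (intro tendsto_intros lim_1_over_n) auto
  also have "(1 - 0 - 2 * (1 / real (Suc r))) / (1 + 0) = (real r - 1) / (real r + 1)"
    by (simp add: field_simps)
  finally have lim: "(\<lambda>s. (1 - 1 / real s - 2 * t s) / (1 + 1 / real s))
      \<longlonglongrightarrow> (real r - 1) / (real r + 1)" .
  \<comment> \<open>This form arises by dividing the numerator and denominator of the relative gain
    by \<open>real s / 2\<close>; \<open>s > 0\<close> is needed for this and for the die to have a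
    face.\<close>
  have "\<forall>\<^sub>F s in sequentially.
      (1 - 1 / real s - 2 * t s) / (1 + 1 / real s) = relative_gain r s"
    using eventually_gt_at_top[of 0]
  proof eventually_elim
    case (elim s)
    have "expected_advantage r s = real s - (\<Sum>k<s. real k ^ r) / real s ^ r"
      using elim assms
      by (simp add: expected_advantage_eq sum_subtractf power_divide sum_divide_distrib)
    also have "\<dots> = real s * (1 - t s)"
      using elim by (simp add: t_def field_simps)
    finally have "relative_gain r s =
        (real s * (1 - t s) - (real s + 1) / 2) / ((real s + 1) / 2)"
      using elim by (simp add: relative_gain_def expected_base_eq)
    also have "\<dots> = (2 * (real s * (1 - t s) - (real s + 1) / 2)) / (2 * ((real s + 1) / 2))"
      by (rule mult_divide_mult_cancel_left[symmetric]) simp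
    also have "\<dots> = (real s * (1 - 1 / real s - 2 * t s)) / (real s * (1 + 1 / real s))"
      using elim by (intro arg_cong2[where f = "(/)"]) (simp_all add: field_simps)
    also have "\<dots> = (1 - 1 / real s - 2 * t s) / (1 + 1 / real s)"
      using elim by (intro mult_divide_mult_cancel_left) simp
    finally show ?case by simp
  qed
  with lim show ?thesis by (rule Lim_transform_eventually)
qed

end
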